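(* Consider the linear systems $Ax = b$ and $Cy = d$. Let $A$ be diagonalizable, and let $B$ have rank one. If $C = A + B$, then $y$ can be computed exactly with an optimal Krylov method in at most double the number of iterations required for $x$.
   Context: Here $A, B, C$ are $n \times n$ complex matrices, $b$ and $d$ are the given right-hand sides, and $x$ and $y$ are the corresponding solutions. Exact arithmetic is assumed. An optimal Krylov method means GMRES, MINRES, or CG (conjugate gradients), if applicable. As to the number of iterations required for $x$: if $A$ is diagonalizable, then the degree of its minimal polynomial equals the number of distinct eigenvalues of $A$, and an optimal Krylov method is taken to compute $x$ exactly in that same number of iterations. *)

theory Defs
  imports "HOL-Analysis.Analysis"
begin

definition diagonalizable :: "complex^'n^'n \<Rightarrow> bool" where
  "diagonalizable A \<longleftrightarrow>
     (\<exists>P D :: complex^'n^'n. invertible P \<and> (\<forall>i j. i \<noteq> j \<longrightarrow> D $ i $ j = 0) \<and> A = P ** D ** matrix_inv P)"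

definition eigenvalues :: "complex^'n^'n \<Rightarrow> complex set" where
  "eigenvalues A = {c. \<exists>v. v \<noteq> 0 \<and> A *v v = c *s v}"

definition hermitian :: "complex^'n^'n \<Rightarrow> bool" where
  "hermitian A \<longleftrightarrow> (\<forall>i j. A $ i $ j = cnj (A $ j $ i))"

(* The library inner product on complex^'n is only real-valued, hence this one. *)
definition cdot :: "complex^'n \<Rightarrow> complex^'n \<Rightarrow> complex" where
  "cdot u v = (\<Sum>i\<in>UNIV. cnj (u $ i) * v $ i)"

definition positive_definite :: "complex^'n^'n \<Rightarrow> bool" where
  "positive_definite A \<longleftrightarrow> hermitian A \<and> (\<forall>v. v \<noteq> 0 \<longrightarrow> 0 < Re (cdot v (A *v v)))"

(* The span is over the complex scalars (vec.span), not the real span of the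
   underlying real vector space. *)
definition krylov_space :: "complex^'n^'n \<Rightarrow> complex^'n \<Rightarrow> nat \<Rightarrow> (complex^'n) set" where
  "krylov_space A r k = vec.span {((\<lambda>v. A *v v) ^^ j) r | j. j < k}"

datatype optimal_krylov_method = GMRES | MINRES | CG

(* Finite termination at the solution is only claimed for nonsingular systems, so
   nonsingularity is part of applicability; for CG it follows from definiteness. *)
fun applicable :: "optimal_krylov_method \<Rightarrow> complex^'n^'n \<Rightarrow> bool" where
  "applicable GMRES A \<longleftrightarrow> invertible A"
| "applicable MINRES A \<longleftrightarrow> invertible A \<and> hermitian A"
| "applicable CG A \<longleftrightarrow> positive_definite A"

(* GMRES and MINRES minimize the Euclidean norm of the residual b - A z; CG minimizes
   the A-norm sqrt (e^* A e) of the error e = A^{-1} b - z. *)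
fun krylov_objective ::
    "optimal_krylov_method \<Rightarrow> complex^'n^'n \<Rightarrow> complex^'n \<Rightarrow> complex^'n \<Rightarrow> real" where
  "krylov_objective GMRES A b z = norm (b - A *v z)"
| "krylov_objective MINRES A b z = norm (b - A *v z)"
| "krylov_objective CG A b z =
     sqrt (Re (cdot (matrix_inv A *v b - z) (A *v (matrix_inv A *v b - z))))"

(* The k-th iterates in exact arithmetic for the initial guess x0: the minimizers of the
   objective over x0 + K_k(A, b - A x0).  When the method is applicable there is exactly
   one.  The sequence is thereby also defined past the step at which an implementation
   would stop. *)
definition krylov_iterates ::
    "optimal_krylov_method \<Rightarrow> complex^'n^'n \<Rightarrow> complex^'n \<Rightarrow> complex^'n \<Rightarrow> nat
      \<Rightarrow> (complex^'n) set" where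
  "krylov_iterates M A b x0 k =
     (let S = (\<lambda>v. x0 + v) ` krylov_space A (b - A *v x0) k
      in {z \<in> S. \<forall>w\<in>S. krylov_objective M A b z \<le> krylov_objective M A b w})"

definition computes_exactly ::
    "optimal_krylov_method \<Rightarrow> complex^'n^'n \<Rightarrow> complex^'n \<Rightarrow> complex^'n \<Rightarrow> nat
      \<Rightarrow> complex^'n \<Rightarrow> bool" where
  "computes_exactly M A b x0 k x \<longleftrightarrow> krylov_iterates M A b x0 k = {x}"

(* The number of iterations required for A x = b depends only on A: it is the number that
   serves every right-hand side and every initial guess.  Particular right-hand sides, such
   as eigenvectors, can need fewer. *)
definition iterations_required ::
    "optimal_krylov_method \<Rightarrow> complex^'n^'n \<Rightarrow> nat \<Rightarrow> bool" where
  "iterations_required M A N \<longleftrightarrow>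
     (\<forall>b x0 x. A *v x = b \<longrightarrow> computes_exactly M A b x0 N x) \<and>
     (\<forall>k<N. \<exists>b x0 x. A *v x = b \<and> \<not> computes_exactly M A b x0 k x)"

end

theory Submission
  imports Defs
begin

text \<open>
  Both upper bounds come from one observation about a nonsingular matrix \<open>M\<close>.  If the initial
  residual \<open>r\<close> lies in an \<open>M\<close>-invariant subspace of dimension at most \<open>m\<close>, then among the first
  \<open>m + 1\<close> vectors \<open>r, M r, M\<^sup>2 r, \<dots>\<close> one depends on its predecessors, so some Krylov space
  \<open>K\<^sub>k\<close> with \<open>k \<le> m\<close> is itself \<open>M\<close>-invariant.  As \<open>M\<close> is injective, it maps \<open>K\<^sub>k\<close> onto itself,
  so the initial error \<open>M\<^sup>-\<^sup>1 r\<close> lies in \<open>K\<^sub>k\<close>.  The solution is then a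
  competitor in the minimization that defines the \<open>k\<close>-th iterate, and it is the only point at
  which the objective vanishes (\<open>computes_exactly_if_error_in_krylov_space\<close>).

  Suitable invariant subspaces are spanned by eigenvectors of \<open>A\<close>.  If \<open>A\<close> is diagonalizable with
  \<open>N\<close> distinct eigenvalues, a vector \<open>r\<close> is a sum of eigenvectors, at most one for each
  eigenvalue; these span an invariant subspace that contains \<open>r\<close> and has dimension at most \<open>N\<close>.
  For \<open>C = A + B\<close> with the range of \<open>B\<close> on the line through \<open>u\<close>, decompose both \<open>r\<close> and \<open>u\<close>: the
  span of the at most \<open>2 N\<close> eigenvectors obtained is \<open>A\<close>-invariant, and it absorbs the
  perturbation because it contains \<open>u\<close>.  So it is \<open>C\<close>-invariant.

  The number \<open>N\<close> cannot be lowered for \<open>A\<close>: take a solution \<open>x\<close> that has a component along every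
  eigenvalue, and the initial guess \<open>0\<close>.  Membership of \<open>x\<close> in \<open>K\<^sub>k(A, A x)\<close> would give a
  polynomial of degree at most \<open>k\<close> with constant term \<open>1\<close> that vanishes at all \<open>N\<close> eigenvalues,
  hence \<open>k \<ge> N\<close>.
\<close>

section \<open>Stagnation of Krylov spaces in an invariant subspace\<close>

lemma finite_krylov_generators:
  "finite {((\<lambda>v. M *v v) ^^ j) r | j. j < (k::nat)}"
  by simp

lemma krylov_space_mono:
  assumes "k \<le> l"
  shows "krylov_space M r k \<subseteq> krylov_space M r l"
  unfolding krylov_space_def using assms by (intro vec.span_mono) auto

text \<open>As long as each new power of \<open>M\<close> leaves the previous Krylov space, the generators stay
  independent and the dimension grows by one in every step.\<close>

lemma krylov_dim_if_no_stagnation: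
  fixes M :: "complex^'n^'n"
  assumes "\<And>k. k < m \<Longrightarrow> ((\<lambda>v. M *v v) ^^ k) r \<notin> krylov_space M r k"
  shows "vec.independent {((\<lambda>v. M *v v) ^^ j) r | j. j < m} \<and>
         card {((\<lambda>v. M *v v) ^^ j) r | j. j < m} = m"
  using assms
proof (induction m)
  case 0
  then show ?case by (simp add: vec.independent_empty)
next
  case (Suc m)
  let ?G = "{((\<lambda>v. M *v v) ^^ j) r | j. j < m}" and ?a = "((\<lambda>v. M *v v) ^^ m) r"
  have *: "{((\<lambda>v. M *v v) ^^ j) r | j. j < Suc m} = insert ?a ?G"
    by (auto simp: less_Suc_eq)
  have IH: "vec.independent ?G \<and> card ?G = m"
    using Suc by auto
  have new: "?a \<notin> vec.span ?G"
    using Suc.prems[of m] by (simp add: krylov_space_def)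
  then have "?a \<notin> ?G"
    by (rule contrapos_nn) (rule vec.span_base)
  then show ?case
    unfolding * using IH new finite_krylov_generators[of M r m]
    by (simp add: vec.independent_insertI card_insert_disjoint)
qed

lemma powers_in_invariant_subspace:
  assumes "\<And>w. w \<in> W \<Longrightarrow> M *v w \<in> W" and "r \<in> W"
  shows "((\<lambda>v. M *v v) ^^ j) r \<in> W"
  using assms by (induction j) auto

lemma krylov_stagnation:
  fixes M :: "complex^'n^'n"
  assumes inv: "\<And>w. w \<in> W \<Longrightarrow> M *v w \<in> W" and r: "r \<in> W"
    and dim: "vec.dim W \<le> m"
  obtains k where "k \<le> m" "((\<lambda>v. M *v v) ^^ k) r \<in> krylov_space M r k"
proof -
  have "\<exists>k < Suc m. ((\<lambda>v. M *v v) ^^ k) r \<in> krylov_space M r k"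
  proof (rule ccontr)
    let ?G = "{((\<lambda>v. M *v v) ^^ j) r | j. j < Suc m}"
    assume "\<not> ?thesis"
    then have *: "vec.independent ?G \<and> card ?G = Suc m"
      by (intro krylov_dim_if_no_stagnation) auto
    moreover have "?G \<subseteq> W"
      using powers_in_invariant_subspace[of W M r] inv r by auto
    ultimately have "Suc m \<le> vec.dim W"
      using vec.independent_card_le_dim[of ?G W] by simp
    with dim show False by simp
  qed
  then show ?thesis using that less_Suc_eq_le by blast
qed

lemma krylov_invariant_if_stagnant:
  fixes M :: "complex^'n^'n"
  assumes "((\<lambda>v. M *v v) ^^ k) r \<in> krylov_space M r k"
  shows "(\<lambda>v. M *v v) ` krylov_space M r k \<subseteq> krylov_space M r k"
proof -
  let ?G = "{((\<lambda>v. M *v v) ^^ j) r | j. j < k}"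
  have "M *v (((\<lambda>v. M *v v) ^^ j) r) \<in> krylov_space M r k" if "j < k" for j
  proof (cases "Suc j = k")
    case True
    then show ?thesis using assms by auto
  next
    case False
    with that have "Suc j < k" by simp
    then have "((\<lambda>v. M *v v) ^^ Suc j) r \<in> ?G" by blast
    then have "((\<lambda>v. M *v v) ^^ Suc j) r \<in> krylov_space M r k"
      unfolding krylov_space_def by (rule vec.span_base)
    then show ?thesis by simp
  qed
  then have "(\<lambda>v. M *v v) ` ?G \<subseteq> krylov_space M r k" by auto
  then have "vec.span ((\<lambda>v. M *v v) ` ?G) \<subseteq> krylov_space M r k"
    by (intro vec.span_minimal) (auto simp: krylov_space_def)
  then show ?thesis
    by (simp add: krylov_space_def vec.linear_span_image matrix_vector_mul_linear_gen)
qed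

text \<open>An injective linear map that sends a finite-dimensional space into itself is onto, which turns
  invariance of the Krylov space into solvability within it.\<close>

lemma error_in_krylov_space:
  fixes M :: "complex^'n^'n"
  assumes M: "invertible M"
    and inv: "\<And>w. w \<in> W \<Longrightarrow> M *v w \<in> W" and W: "M *v e \<in> W"
    and dim: "vec.dim W \<le> m"
  obtains k where "k \<le> m" "e \<in> krylov_space M (M *v e) k"
proof -
  let ?r = "M *v e"
  obtain k where k: "k \<le> m" "((\<lambda>v. M *v v) ^^ k) ?r \<in> krylov_space M ?r k"
    using krylov_stagnation[OF inv W dim] by blast
  let ?K = "krylov_space M ?r k"
  have sub: "vec.subspace ?K"
    by (simp add: krylov_space_def)
  have inj: "inj ((*v) M)"
    using M by (metis invertible_def matrix_left_invertible_injective)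
  have "vec.dim ((*v) M ` ?K) = vec.dim ?K"
    by (rule vec.dim_image_eq[OF matrix_vector_mul_linear_gen]) (metis inj inj_on_subset subset_UNIV)
  then have onto: "(*v) M ` ?K = ?K"
    using krylov_invariant_if_stagnant[OF k(2)] sub
    by (intro vec.subspace_dim_equal vec.subspace_image) auto
  have "?r \<in> ?K"
  proof (cases k)
    \<comment> \<open>Stagnation at the zero space means that the initial residual vanishes.\<close>
    case 0
    then show ?thesis using k(2) by simp
  next
    case (Suc l)
    then have "((\<lambda>v. M *v v) ^^ 0) ?r \<in> {((\<lambda>v. M *v v) ^^ j) ?r | j. j < k}" by blast
    then have "((\<lambda>v. M *v v) ^^ 0) ?r \<in> ?K"
      unfolding krylov_space_def by (rule vec.span_base)
    then show ?thesis by simp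
  qed
  then have "?r \<in> (*v) M ` ?K" using onto by simp
  then have "e \<in> ?K" using inj by (auto dest: injD)
  with k(1) show ?thesis using that by blast
qed

section \<open>Termination of optimal Krylov methods\<close>

lemma invertible_if_positive_definite:
  assumes "positive_definite M"
  shows "invertible M"
proof -
  have "v = 0" if "M *v v = 0" for v
  proof (rule ccontr)
    assume "v \<noteq> 0"
    then have "0 < Re (cdot v (M *v v))"
      using assms by (simp add: positive_definite_def)
    with that show False by (simp add: cdot_def)
  qed
  then show ?thesis
    by (metis invertible_left_inverse matrix_left_invertible_ker)
qed

lemma invertible_if_applicable:
  "applicable m M \<Longrightarrow> invertible M"
  by (cases m) (auto simp: invertible_if_positive_definite)

lemma matrix_inv_mult_vector:
  fixes M :: "complex^'n^'n"
  assumes "invertible M"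
  shows "matrix_inv M *v (M *v x) = x" and "M *v (matrix_inv M *v x) = x"
proof -
  have "M ** matrix_inv M = mat 1 \<and> matrix_inv M ** M = mat 1"
    using assms unfolding invertible_def matrix_inv_def by (rule someI_ex)
  then show "matrix_inv M *v (M *v x) = x" "M *v (matrix_inv M *v x) = x"
    by (simp_all add: matrix_vector_mul_assoc)
qed

lemma krylov_objective_solution:
  fixes M :: "complex^'n^'n"
  assumes "applicable m M" and "M *v x = b"
  shows "krylov_objective m M b x = 0"
  using assms matrix_inv_mult_vector[of M x] invertible_if_applicable[OF assms(1)]
  by (cases m) (auto simp: cdot_def)

lemma krylov_objective_pos:
  fixes M :: "complex^'n^'n"
  assumes app: "applicable m M" and x: "M *v x = b" and z: "z \<noteq> x"
  shows "0 < krylov_objective m M b z"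
proof -
  have M: "invertible M" by (rule invertible_if_applicable[OF app])
  have "M *v z \<noteq> b"
    using x z matrix_inv_mult_vector[OF M] by metis
  moreover have "matrix_inv M *v b - z \<noteq> 0"
    using x z matrix_inv_mult_vector[OF M] by auto
  ultimately show ?thesis
    using app by (cases m) (auto simp: positive_definite_def)
qed

lemma computes_exactly_if_error_in_krylov_space:
  fixes M :: "complex^'n^'n"
  assumes app: "applicable m M" and x: "M *v x = b"
    and err: "x - x0 \<in> krylov_space M (b - M *v x0) k"
  shows "computes_exactly m M b x0 k x"
proof -
  let ?S = "(\<lambda>v. x0 + v) ` krylov_space M (b - M *v x0) k"
  have xS: "x \<in> ?S" using err by (intro image_eqI[of _ _ "x - x0"]) auto
  have "krylov_objective m M b x \<le> krylov_objective m M b w" for w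
    using krylov_objective_solution[OF app x] krylov_objective_pos[OF app x, of w]
    by (cases "w = x") auto
  moreover have "z = x" if "krylov_objective m M b z \<le> krylov_objective m M b x" for z
    using krylov_objective_solution[OF app x] krylov_objective_pos[OF app x, of z] that by force
  ultimately show ?thesis
    using xS by (auto simp: computes_exactly_def krylov_iterates_def Let_def)
qed

text \<open>The conclusion covers every step from \<open>k\<close> on, since later Krylov spaces still contain the
  error: the number of iterations required for \<open>A\<close> is a fixed step, whatever the step at which a
  particular residual stagnates.\<close>

lemma computes_exactly_within_invariant_dim:
  fixes M :: "complex^'n^'n"
  assumes app: "applicable m M" and x: "M *v x = b"
    and inv: "\<And>w. w \<in> W \<Longrightarrow> M *v w \<in> W" and W: "b - M *v x0 \<in> W"
    and dim: "vec.dim W \<le> n"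
  obtains k where "k \<le> n" "\<And>l. k \<le> l \<Longrightarrow> computes_exactly m M b x0 l x"
proof -
  have r: "M *v (x - x0) = b - M *v x0"
    using x by (simp add: matrix_vector_mult_diff_distrib)
  obtain k where k: "k \<le> n" "x - x0 \<in> krylov_space M (b - M *v x0) k"
    using error_in_krylov_space[OF invertible_if_applicable[OF app] inv _ dim, of "x - x0"] W r
    by metis
  then have "computes_exactly m M b x0 l x" if "k \<le> l" for l
    using computes_exactly_if_error_in_krylov_space[OF app x] krylov_space_mono[OF that] by blast
  with k(1) show ?thesis using that by blast
qed

section \<open>Eigenvectors of a diagonalizable matrix\<close>

lemma diagonalizable_coordinates:
  fixes A :: "complex^'n^'n"
  assumes "diagonalizable A"
  obtains P :: "complex^'n^'n" and d :: "'n \<Rightarrow> complex"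
  where "invertible P" "\<And>w. A *v (P *v w) = P *v (\<chi> i. d i * w $ i)"
    "eigenvalues A = range d"
proof -
  obtain P D :: "complex^'n^'n" where P: "invertible P"
    and D: "\<And>i j. i \<noteq> j \<Longrightarrow> D $ i $ j = 0" and A: "A = P ** D ** matrix_inv P"
    using assms unfolding diagonalizable_def by blast
  define d where "d i = D $ i $ i" for i
  have "(D *v w) $ i = d i * w $ i" for w i
  proof -
    have "(\<Sum>j\<in>UNIV. D $ i $ j * w $ j) = (\<Sum>j\<in>UNIV. if j = i then d i * w $ i else 0)"
      by (rule sum.cong) (auto simp: d_def D)
    then show ?thesis by (simp add: matrix_vector_mult_def)
  qed
  then have Dw: "D *v w = (\<chi> i. d i * w $ i)" for w
    by (simp add: vec_eq_iff)
  have AP: "A *v (P *v w) = P *v (\<chi> i. d i * w $ i)" for w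
    using matrix_inv_mult_vector[OF P] by (simp add: A Dw flip: matrix_vector_mul_assoc)
  have inj: "P *v v = P *v w \<longleftrightarrow> v = w" for v w
    using matrix_inv_mult_vector[OF P] by metis
  have surj: "\<exists>w. v = P *v w" for v
    using matrix_inv_mult_vector(2)[OF P] by metis
  have "c \<in> range d" if "v \<noteq> 0" "A *v v = c *s v" for c v
  proof -
    obtain w where w: "v = P *v w" using surj by blast
    have "w \<noteq> 0" using that(1) w by auto
    then obtain i where i: "w $ i \<noteq> 0" by (auto simp: vec_eq_iff)
    have "P *v (\<chi> i. d i * w $ i) = P *v (c *s w)"
      using that(2) AP[of w] w by (simp add: vector_scalar_commute)
    then have "(\<chi> i. d i * w $ i) = c *s w" by (simp only: inj)
    then have "d i * w $ i = c * w $ i" by (simp add: vec_eq_iff)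
    with i show ?thesis by auto
  qed
  moreover have "\<exists>v. v \<noteq> 0 \<and> A *v v = d i *s v" for i
  proof (intro exI conjI)
    show "P *v axis i 1 \<noteq> 0"
      using inj[of "axis i 1" 0] by (simp add: axis_eq_0_iff)
    have "(\<chi> j. d j * axis i 1 $ j) = d i *s axis i (1::complex)"
      by (simp add: vec_eq_iff axis_def)
    then show "A *v (P *v axis i 1) = d i *s (P *v axis i 1)"
      by (simp add: AP vector_scalar_commute)
  qed
  ultimately have "eigenvalues A = range d"
    unfolding eigenvalues_def by blast
  with P AP show ?thesis using that by blast
qed

lemma finite_eigenvalues_if_diagonalizable:
  "diagonalizable A \<Longrightarrow> finite (eigenvalues A)"
  by (metis diagonalizable_coordinates finite_class.finite_UNIV finite_imageI)

text \<open>Coordinates in an eigenbasis are grouped by eigenvalue, so that the number of summands is the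
  number of distinct eigenvalues and not the size of the matrix.  A summand may be zero.\<close>

lemma eigenvector_decomposition:
  fixes A :: "complex^'n^'n"
  assumes "diagonalizable A"
  obtains v where "r = (\<Sum>c\<in>eigenvalues A. v c)" "\<And>c. A *v v c = c *s v c"
proof -
  obtain P :: "complex^'n^'n" and d where P: "invertible P"
    and AP: "\<And>w. A *v (P *v w) = P *v (\<chi> i. d i * w $ i)"
    and eig: "eigenvalues A = range d"
    using diagonalizable_coordinates[OF assms] by blast
  obtain w where w: "r = P *v w"
    using matrix_inv_mult_vector(2)[OF P] by metis
  define w' where "w' c = (\<chi> i. if d i = c then w $ i else 0)" for c
  have "w = (\<Sum>c\<in>range d. w' c)"
    by (simp add: vec_eq_iff w'_def)
  then have "r = (\<Sum>c\<in>eigenvalues A. P *v w' c)"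
    by (simp add: w eig vec.linear_sum[OF matrix_vector_mul_linear_gen])
  moreover have "(\<chi> i. d i * w' c $ i) = c *s w' c" for c
    by (simp add: vec_eq_iff w'_def)
  then have "A *v (P *v w' c) = c *s (P *v w' c)" for c
    by (simp add: AP vector_scalar_commute)
  ultimately show ?thesis using that by blast
qed

lemma small_invariant_subspace:
  fixes A :: "complex^'n^'n"
  assumes A: "diagonalizable A"
  obtains G where "finite G" "card G \<le> card (eigenvalues A)" "r \<in> vec.span G"
    "\<And>g. g \<in> G \<Longrightarrow> A *v g \<in> vec.span G"
proof -
  obtain v where v: "r = (\<Sum>c\<in>eigenvalues A. v c)" "\<And>c. A *v v c = c *s v c"
    using eigenvector_decomposition[OF A] by blast
  let ?G = "v ` eigenvalues A"
  have fin: "finite (eigenvalues A)" by (rule finite_eigenvalues_if_diagonalizable[OF A])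
  show ?thesis
  proof
    show "finite ?G" "card ?G \<le> card (eigenvalues A)"
      using fin by (auto intro: card_image_le)
    show "r \<in> vec.span ?G"
      unfolding v(1) by (intro vec.span_sum vec.span_base) auto
    show "A *v g \<in> vec.span ?G" if "g \<in> ?G" for g
    proof -
      from that obtain c where "A *v g = c *s g" using v(2) by blast
      then show ?thesis using that by (simp add: vec.span_scale vec.span_base)
    qed
  qed
qed

lemma span_invariant:
  fixes A :: "complex^'n^'n"
  assumes "\<And>g. g \<in> G \<Longrightarrow> A *v g \<in> vec.span G" and "w \<in> vec.span G"
  shows "A *v w \<in> vec.span G"
proof -
  have "(*v) A ` vec.span G = vec.span ((*v) A ` G)"
    by (simp add: vec.linear_span_image matrix_vector_mul_linear_gen)
  also have "\<dots> \<subseteq> vec.span G"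
    using assms(1) by (intro vec.span_minimal) auto
  finally show ?thesis using assms(2) by blast
qed

section \<open>Sharpness of the number of distinct eigenvalues\<close>

lemma krylov_space_explicit:
  fixes M :: "complex^'n^'n"
  assumes "z \<in> krylov_space M r k"
  obtains c where "z = (\<Sum>j<k. c j *s ((\<lambda>v. M *v v) ^^ j) r)"
proof -
  have "\<exists>c. z = (\<Sum>j<k. c j *s ((\<lambda>v. M *v v) ^^ j) r)"
    using assms unfolding krylov_space_def
  proof (induction rule: vec.span_induct_alt)
    case base
    show ?case by (rule exI[of _ "\<lambda>_. 0"]) simp
  next
    case (step a g z)
    then obtain c i where i: "i < k" "g = ((\<lambda>v. M *v v) ^^ i) r"
      and c: "z = (\<Sum>j<k. c j *s ((\<lambda>v. M *v v) ^^ j) r)" by auto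
    have "(\<Sum>j<k. (if j = i then a else 0) *s ((\<lambda>v. M *v v) ^^ j) r) =
        (\<Sum>j<k. if j = i then a *s g else 0)"
      by (rule sum.cong) (auto simp: i(2))
    also have "\<dots> = a *s g" using i(1) by simp
    finally have "a *s g + z =
        (\<Sum>j<k. ((if j = i then a else 0) + c j) *s ((\<lambda>v. M *v v) ^^ j) r)"
      by (simp add: c vector_sadd_rdistrib sum.distrib)
    then show ?case by (rule exI[where x = "\<lambda>j. (if j = i then a else 0) + c j"])
  qed
  then show ?thesis using that by blast
qed

text \<open>The vector with all coordinates \<open>1\<close> in an eigenbasis has a component along every eigenvalue,
  so its minimal annihilating polynomial is that of the matrix.\<close>

lemma generic_vector:
  fixes A :: "complex^'n^'n"
  assumes "diagonalizable A"
  obtains x where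
    "\<And>c (n::nat) l. (\<Sum>j\<le>n. c j *s ((\<lambda>v. A *v v) ^^ j) x) = 0 \<Longrightarrow> l \<in> eigenvalues A \<Longrightarrow>
       (\<Sum>j\<le>n. c j * l ^ j) = 0"
proof -
  obtain P :: "complex^'n^'n" and d where P: "invertible P"
    and AP: "\<And>w. A *v (P *v w) = P *v (\<chi> i. d i * w $ i)"
    and eig: "eigenvalues A = range d"
    using diagonalizable_coordinates[OF assms] by blast
  let ?x = "P *v (\<chi> i. 1)"
  have pow: "((\<lambda>v. A *v v) ^^ j) ?x = P *v (\<chi> i. d i ^ j)" for j
    by (induction j) (simp_all add: AP)
  show ?thesis
  proof
    fix c :: "nat \<Rightarrow> complex" and n l
    assume 0: "(\<Sum>j\<le>n. c j *s ((\<lambda>v. A *v v) ^^ j) ?x) = 0" and "l \<in> eigenvalues A"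
    then obtain i where l: "l = d i" using eig by auto
    have "P *v (\<Sum>j\<le>n. c j *s (\<chi> i. d i ^ j)) = 0"
      using 0 by (simp add: pow vec.linear_sum[OF matrix_vector_mul_linear_gen]
          vector_scalar_commute)
    then have "(\<Sum>j\<le>n. c j *s (\<chi> i. d i ^ j)) = 0"
      using matrix_inv_mult_vector[OF P] by (metis matrix_vector_mult_0_right)
    then have "(\<Sum>j\<le>n. c j *s (\<chi> i. d i ^ j)) $ i = 0" by simp
    then show "(\<Sum>j\<le>n. c j * l ^ j) = 0" by (simp add: l)
  qed
qed

lemma generic_error_needs_all_eigenvalues:
  fixes A :: "complex^'n^'n"
  assumes A: "diagonalizable A"
  obtains x where "\<And>k. k < card (eigenvalues A) \<Longrightarrow> x \<notin> krylov_space A (A *v x) k"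
proof -
  obtain x where x: "\<And>c (n::nat) l. (\<Sum>j\<le>n. c j *s ((\<lambda>v. A *v v) ^^ j) x) = 0 \<Longrightarrow>
      l \<in> eigenvalues A \<Longrightarrow> (\<Sum>j\<le>n. c j * l ^ j) = 0"
    using generic_vector[OF A] by blast
  have "card (eigenvalues A) \<le> k" if K: "x \<in> krylov_space A (A *v x) k" for k
  proof -
    obtain c where c: "x = (\<Sum>j<k. c j *s ((\<lambda>v. A *v v) ^^ j) (A *v x))"
      using krylov_space_explicit[OF K] by blast
    \<comment> \<open>The coefficients of \<open>1 - \<Sum>\<^sub>j c\<^sub>j t\<^sup>j\<^sup>+\<^sup>1\<close>, which annihilates \<open>x\<close>.\<close>
    define p where "p j = (case j of 0 \<Rightarrow> 1 | Suc i \<Rightarrow> - c i)" for j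
    have "(\<Sum>j\<le>k. p j *s ((\<lambda>v. A *v v) ^^ j) x) =
        x + (\<Sum>j<k. - c j *s ((\<lambda>v. A *v v) ^^ Suc j) x)"
      by (subst sum.atMost_shift) (simp add: p_def)
    also have "\<dots> = x - (\<Sum>j<k. c j *s ((\<lambda>v. A *v v) ^^ j) (A *v x))"
      by (simp add: funpow_swap1 sum_negf)
    also have "\<dots> = 0" using c by simp
    finally have "eigenvalues A \<subseteq> {l. (\<Sum>j\<le>k. p j * l ^ j) = 0}"
      using x by blast
    moreover have "finite {l. (\<Sum>j\<le>k. p j * l ^ j) = 0} \<and>
        card {l. (\<Sum>j\<le>k. p j * l ^ j) = 0} \<le> k"
      by (rule polyfun_rootbound) (auto simp: p_def intro!: exI[of _ 0])
    ultimately show ?thesis using card_mono le_trans by blast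
  qed
  then show ?thesis using that by force
qed

lemma iterations_required_card_eigenvalues:
  fixes A :: "complex^'n^'n"
  assumes A: "diagonalizable A" and app: "applicable m A"
  shows "iterations_required m A (card (eigenvalues A))"
  unfolding iterations_required_def
proof (intro conjI allI impI)
  fix b x0 x assume x: "A *v x = b"
  obtain G where G: "finite G" "card G \<le> card (eigenvalues A)" "b - A *v x0 \<in> vec.span G"
    "\<And>g. g \<in> G \<Longrightarrow> A *v g \<in> vec.span G"
    using small_invariant_subspace[OF A] by blast
  have "vec.dim (vec.span G) \<le> card (eigenvalues A)"
    using vec.dim_le_card[of "vec.span G" G] G(1,2) by auto
  then show "computes_exactly m A b x0 (card (eigenvalues A)) x"
    using computes_exactly_within_invariant_dim[OF app x span_invariant[OF G(4)] G(3)] by blast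
next
  fix k assume k: "k < card (eigenvalues A)"
  obtain x where x: "x \<notin> krylov_space A (A *v x) k"
    using generic_error_needs_all_eigenvalues[OF A] k by blast
  have "\<not> computes_exactly m A (A *v x) 0 k x"
    using x by (auto simp: computes_exactly_def krylov_iterates_def Let_def)
  then show "\<exists>b x0 x. A *v x = b \<and> \<not> computes_exactly m A b x0 k x"
    by blast
qed

section \<open>Rank-one perturbations\<close>

text \<open>The rank counts rows: they are all multiples \<open>u\<^sub>i w\<close> of one vector \<open>w\<close>, so \<open>B\<close> sends every
  vector to a multiple of the column \<open>u\<close>.\<close>

lemma rank_one_range:
  fixes B :: "complex^'n^'m"
  assumes "rank B = 1"
  obtains u where "\<And>z. \<exists>s. B *v z = s *s u"
proof -
  obtain S where S: "rows B \<subseteq> vec.span S" "card S = vec.dim (rows B)"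
    using vec.basis_exists[of "rows B"] by metis
  then obtain w where "S = {w}"
    using assms by (auto simp: row_rank_def_gen card_1_singleton_iff)
  then have "\<exists>s. row i B = s *s w" for i
    using S(1) by (auto simp: rows_def vec.span_singleton)
  then obtain u where u: "\<And>i. row i B = u i *s w" by metis
  then have B: "B $ i $ j = u i * w $ j" for i j
    by (metis row_def vec_lambda_eta vector_smult_component)
  have "B *v z = (\<Sum>j\<in>UNIV. w $ j * z $ j) *s (\<chi> i. u i)" for z
    by (simp add: vec_eq_iff matrix_vector_mult_def B sum_distrib_left mult_ac)
  then show ?thesis using that by blast
qed

text \<open>The two halves of the bound \<open>2 N\<close> are the eigenvectors of \<open>A\<close> that compose the residual and
  those that compose the direction \<open>u\<close> of the perturbation.\<close>

lemma rank_one_perturbation_terminates: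
  fixes A B C :: "complex^'n^'n"
  assumes A: "diagonalizable A" and B: "rank B = 1" and C: "C = A + B"
    and app: "applicable m C" and y: "C *v y = d"
  shows "\<exists>k \<le> 2 * card (eigenvalues A). computes_exactly m C d y0 k y"
proof -
  obtain u where u: "\<And>z. \<exists>s. B *v z = s *s u"
    using rank_one_range[OF B] by blast
  obtain G where G: "finite G" "card G \<le> card (eigenvalues A)" "d - C *v y0 \<in> vec.span G"
    "\<And>g. g \<in> G \<Longrightarrow> A *v g \<in> vec.span G"
    using small_invariant_subspace[OF A] by blast
  obtain H where H: "finite H" "card H \<le> card (eigenvalues A)" "u \<in> vec.span H"
    "\<And>g. g \<in> H \<Longrightarrow> A *v g \<in> vec.span H"
    using small_invariant_subspace[OF A] by blast
  let ?W = "vec.span (G \<union> H)"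
  have sub: "vec.span G \<subseteq> ?W" "vec.span H \<subseteq> ?W"
    by (auto intro: vec.span_mono[THEN subsetD])
  have "A *v w \<in> ?W" if "w \<in> ?W" for w
    using that by (rule span_invariant[rotated]) (use G(4) H(4) sub in auto)
  moreover have "B *v w \<in> ?W" for w
    using u[of w] H(3) sub by (auto intro!: vec.span_scale)
  ultimately have inv: "C *v w \<in> ?W" if "w \<in> ?W" for w
    using that by (auto simp: C matrix_vector_mult_add_rdistrib intro!: vec.span_add)
  have "vec.dim ?W \<le> card (G \<union> H)"
    using vec.dim_le_card[of ?W "G \<union> H"] G(1) H(1) by auto
  also have "\<dots> \<le> 2 * card (eigenvalues A)"
    using card_Un_le[of G H] G(2) H(2) by linarith
  finally have dim: "vec.dim ?W \<le> 2 * card (eigenvalues A)" .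
  have "d - C *v y0 \<in> ?W" using G(3) sub by blast
  then show ?thesis
    using computes_exactly_within_invariant_dim[OF app y inv _ dim] by blast
qed

theorem theorem2p1:
  fixes A B C :: "complex^'n^'n" and b d x y :: "complex^'n"
  assumes "A *v x = b" and "C *v y = d"
    and "diagonalizable A"
    and "rank B = 1"
    and "C = A + B"
    and "invertible C"
  shows "let N = card (eigenvalues A) in
      (\<forall>M. applicable M A \<longrightarrow>
         iterations_required M A N \<and> (\<forall>x0. computes_exactly M A b x0 N x)) \<and>
      (\<forall>M. applicable M C \<longrightarrow>
         (\<forall>y0. \<exists>k \<le> 2 * N. computes_exactly M C d y0 k y))"
proof -
  have "iterations_required M A (card (eigenvalues A))" if "applicable M A" for M
    using iterations_required_card_eigenvalues assms(3) that by blast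
  moreover from this have "computes_exactly M A b x0 (card (eigenvalues A)) x"
    if "applicable M A" for M x0
    using that assms(1) unfolding iterations_required_def by blast
  ultimately show ?thesis
    using rank_one_perturbation_terminates[OF assms(3-5) _ assms(2)] by (simp add: Let_def)
qed

end
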